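(* Let $\kappa$ be an infinite cardinal, let $X$ be a real Banach space and let $Y$ be a subspace of $X$. (1) If $X$ is $<\kappa$-octahedral and $Y$ is a $\kappa$ almost isometric ideal in $X$, then $Y$ is $<\kappa$-octahedral. (2) If $X$ fails the $(-1)$-$\mathrm{BCP}_{<\kappa}$ and $Y$ is a $\kappa$ isometric ideal in $X$, then $Y$ fails the $(-1)$-$\mathrm{BCP}_{<\kappa}$.
   Context: For a normed space $Z$, $\operatorname{dens}(Z)$ is the least cardinality of a subset of $Z$ whose linear span is dense in $Z$ (so it equals $\dim Z$ if $Z$ is finite dimensional); $S_Z$ is its unit sphere. A subspace $Y$ of a Banach space $X$ is a $\kappa$ isometric ideal (resp. $\kappa$ almost isometric ideal) in $X$ if for every subspace $E\subseteq X$ with $\operatorname{dens}(E)<\kappa$ (resp. and every $\varepsilon>0$) there is a linear operator $T:E\to Y$ with $T(e)=e$ for all $e\in E\cap Y$ and $\|T(e)\|=\|e\|$ (resp. $(1-\varepsilon)\|e\|\le\|T(e)\|\le(1+\varepsilon)\|e\|$) for all $e\in E$. A normed space $X$ is $<\kappa$-octahedral if for every subspace $Z\subseteq X$ with $\operatorname{dens}(Z)<\kappa$ and every $\varepsilon>0$ there is $x\in S_X$ such that $\|z+\lambda x\|\ge(1-\varepsilon)(\|z\|+|\lambda|)$ for all $z\in Z$, $\lambda\in\mathbb R$. A normed space $X$ fails the $(-1)$-$\mathrm{BCP}_{<\kappa}$ if for every subspace $Z\subseteq X$ with $\operatorname{dens}(Z)<\kappa$ there is $x\in S_X$ such that $\|z+\lambda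 x\|=\|z\|+|\lambda|$ for all $z\in Z$, $\lambda\in\mathbb R$. *)

theory Defs
  imports "HOL-Analysis.Analysis"
begin

unbundle cardinal_syntax

text \<open>
  Cardinals are represented by cardinal orders (\<^const>\<open>Card_order\<close>) over an arbitrary type; a
  normed space is a linear subspace of an ambient type. Subspaces are not required to be closed.
\<close>

definition dense_span_in :: "'a::real_normed_vector set \<Rightarrow> 'a set \<Rightarrow> bool" where
  "dense_span_in A Z \<longleftrightarrow> A \<subseteq> Z \<and> Z \<subseteq> closure (span A)"

text \<open>
  The choice is over a nonempty collection (\<open>Z\<close> itself has dense span in \<open>Z\<close>), and
  all minimisers have the same cardinality; see \<open>dens_attained\<close> and \<open>dens_le\<close> below.
\<close>

definition dens :: "'a::real_normed_vector set \<Rightarrow> 'a rel" where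
  "dens Z = |SOME A. dense_span_in A Z \<and> (\<forall>B. dense_span_in B Z \<longrightarrow> |A| \<le>o |B| )|"

lemma dens_attained:
  fixes Z :: "'a::real_normed_vector set"
  obtains A where "dense_span_in A Z" "dens Z = |A|" "\<And>B. dense_span_in B Z \<Longrightarrow> |A| \<le>o |B|"
proof -
  let ?P = "\<lambda>A. dense_span_in A Z \<and> (\<forall>B. dense_span_in B Z \<longrightarrow> |A| \<le>o |B| )"
  have "dense_span_in Z Z"
    unfolding dense_span_in_def using span_superset[of Z] closure_subset[of "span Z"] by blast
  then have "\<exists>r \<in> card_of ` {A. dense_span_in A Z}. \<forall>r' \<in> card_of ` {A. dense_span_in A Z}. r \<le>o r'"
    by (intro exists_minim_Card_order) (auto simp: card_of_Card_order)
  then have "\<exists>A. ?P A" by auto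
  then have "?P (SOME A. ?P A)" by (rule someI_ex)
  then show ?thesis using that unfolding dens_def by blast
qed

lemma dens_le: "dense_span_in A Z \<Longrightarrow> dens Z \<le>o |A|"
  by (rule dens_attained[of Z]) auto

lemma dens_less_iff: "dens Z <o \<kappa> \<longleftrightarrow> (\<exists>A. dense_span_in A Z \<and> |A| <o \<kappa>)"
  by (metis dens_attained dens_le ordLeq_ordLess_trans)

definition linear_map_between ::
  "'a::real_vector set \<Rightarrow> 'b::real_vector set \<Rightarrow> ('a \<Rightarrow> 'b) \<Rightarrow> bool" where
  "linear_map_between E Y T \<longleftrightarrow>
     T ` E \<subseteq> Y \<and>
     (\<forall>x\<in>E. \<forall>y\<in>E. T (x + y) = T x + T y) \<and>
     (\<forall>c. \<forall>x\<in>E. T (c *\<^sub>R x) = c *\<^sub>R T x)"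

text \<open>In the next two definitions the ambient Banach space is the whole type.\<close>

definition isometric_ideal :: "'k rel \<Rightarrow> 'a::banach set \<Rightarrow> bool" where
  "isometric_ideal \<kappa> Y \<longleftrightarrow>
     (\<forall>E. subspace E \<and> dens E <o \<kappa> \<longrightarrow>
        (\<exists>T. linear_map_between E Y T \<and>
             (\<forall>e \<in> E \<inter> Y. T e = e) \<and>
             (\<forall>e \<in> E. norm (T e) = norm e)))"

definition almost_isometric_ideal :: "'k rel \<Rightarrow> 'a::banach set \<Rightarrow> bool" where
  "almost_isometric_ideal \<kappa> Y \<longleftrightarrow>
     (\<forall>E. subspace E \<and> dens E <o \<kappa> \<longrightarrow>
        (\<forall>\<epsilon>>0. \<exists>T. linear_map_between E Y T \<and>
             (\<forall>e \<in> E \<inter> Y. T e = e) \<and>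
             (\<forall>e \<in> E. (1 - \<epsilon>) * norm e \<le> norm (T e) \<and> norm (T e) \<le> (1 + \<epsilon>) * norm e)))"

definition octahedral_below :: "'k rel \<Rightarrow> 'a::real_normed_vector set \<Rightarrow> bool" where
  "octahedral_below \<kappa> X \<longleftrightarrow>
     (\<forall>Z. subspace Z \<and> Z \<subseteq> X \<and> dens Z <o \<kappa> \<longrightarrow>
        (\<forall>\<epsilon>>0. \<exists>x\<in>X. norm x = 1 \<and>
             (\<forall>z\<in>Z. \<forall>c. norm (z + c *\<^sub>R x) \<ge> (1 - \<epsilon>) * (norm z + \<bar>c\<bar>))))"

definition fails_minus_one_BCP_below :: "'k rel \<Rightarrow> 'a::real_normed_vector set \<Rightarrow> bool" where
  "fails_minus_one_BCP_below \<kappa> X \<longleftrightarrow>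
     (\<forall>Z. subspace Z \<and> Z \<subseteq> X \<and> dens Z <o \<kappa> \<longrightarrow>
        (\<exists>x\<in>X. norm x = 1 \<and>
             (\<forall>z\<in>Z. \<forall>c. norm (z + c *\<^sub>R x) = norm z + \<bar>c\<bar>)))"

end

theory Submission
  imports Defs
begin

text \<open>
  Adjoining a single vector to a subspace of density character below an infinite cardinal keeps
  it below that cardinal. So let \<open>Z\<close> be a small subspace of \<open>Y\<close> and let \<open>x\<close> be a unit vector of the
  whole space that is (almost) \<open>\<ell>\<^sub>1\<close>-orthogonal to \<open>Z\<close>. The span of \<open>Z\<close> and \<open>x\<close> is still small, so
  the ideal property yields an operator \<open>T\<close> from this span into \<open>Y\<close> that fixes \<open>Z\<close> and is
  (almost) isometric. Since \<open>T (z + c x) = z + c T x\<close> for \<open>z\<close> in \<open>Z\<close>, the vector \<open>T x\<close> of \<open>Y\<close>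
  inherits the (almost) \<open>\<ell>\<^sub>1\<close>-orthogonality to \<open>Z\<close>.

  In the isometric case \<open>T x\<close> already has norm one. In the almost isometric case it has to be
  normalised; if both errors are at most \<open>\<delta>\<close>, the constant obtained is \<open>(1 - \<delta>)\<^sup>2 / (1 + \<delta>)\<close>, which
  is at least \<open>1 - 3 \<delta>\<close>.
\<close>

lemma subspace_closure:
  fixes S :: "'a::real_normed_vector set"
  assumes "subspace S"
  shows "subspace (closure S)"
proof (rule subspaceI)
  show "0 \<in> closure S"
    using subspace_0[OF assms] closure_subset[of S] by (rule rev_subsetD)
  show "x + y \<in> closure S" if xy: "x \<in> closure S" "y \<in> closure S" for x y
  proof -
    obtain f where f: "\<forall>n. f n \<in> S" "f \<longlonglongrightarrow> x"
      using xy(1) unfolding closure_sequential by auto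
    obtain g where g: "\<forall>n. g n \<in> S" "g \<longlonglongrightarrow> y"
      using xy(2) unfolding closure_sequential by auto
    have "\<forall>n. f n + g n \<in> S"
      using f(1) g(1) assms by (simp add: subspace_add)
    moreover have "(\<lambda>n. f n + g n) \<longlonglongrightarrow> x + y"
      using f(2) g(2) by (rule tendsto_add)
    ultimately show ?thesis
      unfolding closure_sequential by (intro exI conjI)
  qed
  show "c *\<^sub>R x \<in> closure S" if x: "x \<in> closure S" for c x
  proof -
    obtain f where f: "\<forall>n. f n \<in> S" "f \<longlonglongrightarrow> x"
      using x unfolding closure_sequential by auto
    have "\<forall>n. c *\<^sub>R f n \<in> S"
      using f(1) assms by (simp add: subspace_scale)
    moreover have "(\<lambda>n. c *\<^sub>R f n) \<longlonglongrightarrow> c *\<^sub>R x"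
      using tendsto_const f(2) by (rule tendsto_scaleR)
    ultimately show ?thesis
      unfolding closure_sequential by (intro exI conjI)
  qed
qed

text \<open>
  The closure of the span of \<open>A\<close> is itself a linear subspace, so it swallows the span of
  everything it contains.
\<close>

lemma dense_span_in_span_insert:
  assumes "dense_span_in A Z"
  shows "dense_span_in (insert x A) (span (insert x Z))"
proof -
  have "A \<subseteq> Z" "Z \<subseteq> closure (span A)"
    using assms by (auto simp: dense_span_in_def)
  have "span A \<subseteq> span (insert x A)"
    by (intro span_mono) auto
  then have "Z \<subseteq> closure (span (insert x A))"
    using \<open>Z \<subseteq> closure (span A)\<close> by (meson closure_mono subset_trans)
  moreover have "x \<in> closure (span (insert x A))"
    by (rule subsetD[OF closure_subset span_base]) simp
  ultimately have "span (insert x Z) \<subseteq> closure (span (insert x A))"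
    by (intro span_minimal subspace_closure subspace_span) simp
  moreover have "insert x A \<subseteq> span (insert x Z)"
    using \<open>A \<subseteq> Z\<close> span_superset[of "insert x Z"] by blast
  ultimately show ?thesis
    by (simp add: dense_span_in_def)
qed

lemma dens_span_insert_less:
  assumes "Cinfinite \<kappa>" and "dens Z <o \<kappa>"
  shows "dens (span (insert x Z)) <o \<kappa>"
proof -
  obtain A where A: "dense_span_in A Z" "|A| <o \<kappa>"
    using assms(2) dens_less_iff by blast
  have inf: "infinite (Field \<kappa>)" and co: "Card_order \<kappa>"
    using assms(1) by (auto simp: cinfinite_def)
  have "|{x}| <o \<kappa>"
    using inf co by (intro finite_ordLess_infinite) (simp_all add: card_of_well_order_on card_order_on_well_order_on Field_card_of)
  then have "|insert x A| <o \<kappa>"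
    using card_of_Un_ordLess_infinite_Field[OF inf co _ A(2), of "{x}"] by simp
  with dense_span_in_span_insert[OF A(1)] show ?thesis
    using dens_less_iff by blast
qed

text \<open>
  This identity is what makes the ideal property useful: it turns norm estimates for \<open>z + c x\<close>
  into estimates for \<open>z + c T x\<close>.
\<close>

lemma linear_map_between_fixing_add_scaleR:
  assumes "linear_map_between (span (insert x Z)) Y T"
    and "\<forall>e \<in> span (insert x Z) \<inter> Y. T e = e" and "Z \<subseteq> Y" and "z \<in> Z"
  shows "z + c *\<^sub>R x \<in> span (insert x Z)" and "T (z + c *\<^sub>R x) = z + c *\<^sub>R T x"
proof -
  have mem: "z \<in> span (insert x Z)" "x \<in> span (insert x Z)"
    using \<open>z \<in> Z\<close> by (auto intro: span_base)
  then show "z + c *\<^sub>R x \<in> span (insert x Z)"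
    by (intro span_add span_scale)
  have "T (z + c *\<^sub>R x) = T z + c *\<^sub>R T x"
    using assms(1) mem by (simp add: linear_map_between_def span_scale)
  with assms mem show "T (z + c *\<^sub>R x) = z + c *\<^sub>R T x"
    by auto
qed

lemma octahedral_below_almost_isometric_ideal:
  fixes Y :: "'a::banach set"
  assumes "Cinfinite \<kappa>" and "subspace Y"
    and oct: "octahedral_below \<kappa> (UNIV :: 'a set)" and ideal: "almost_isometric_ideal \<kappa> Y"
  shows "octahedral_below \<kappa> Y"
  unfolding octahedral_below_def
proof (intro allI impI)
  fix Z :: "'a set" and \<epsilon> :: real
  assume Z: "subspace Z \<and> Z \<subseteq> Y \<and> dens Z <o \<kappa>" and "\<epsilon> > 0"
  \<comment> \<open>One third of \<open>\<epsilon>\<close> pays for the two errors and for the normalisation; the cap \<open>1 / 2\<close> keeps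
    \<open>1 - \<delta>\<close> positive, so that \<open>T x\<close> below is nonzero.\<close>
  define \<delta> where "\<delta> = min (\<epsilon> / 3) (1 / 2)"
  have \<delta>: "0 < \<delta>" "\<delta> < 1" "3 * \<delta> \<le> \<epsilon>"
    using \<open>\<epsilon> > 0\<close> by (auto simp: \<delta>_def)
  obtain x where x: "norm x = 1"
    and oct_x: "\<And>z c. z \<in> Z \<Longrightarrow> norm (z + c *\<^sub>R x) \<ge> (1 - \<delta>) * (norm z + \<bar>c\<bar>)"
    using oct Z \<delta>(1) unfolding octahedral_below_def by blast
  let ?E = "span (insert x Z)"
  have "dens ?E <o \<kappa>"
    using assms(1) Z dens_span_insert_less by blast
  then obtain T where T: "linear_map_between ?E Y T" "\<forall>e \<in> ?E \<inter> Y. T e = e"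
    and T_norm: "\<And>e. e \<in> ?E \<Longrightarrow> (1 - \<delta>) * norm e \<le> norm (T e) \<and> norm (T e) \<le> (1 + \<delta>) * norm e"
    using ideal \<delta>(1) subspace_span unfolding almost_isometric_ideal_def by meson
  have "x \<in> ?E"
    by (simp add: span_base)
  define t where "t = norm (T x)"
  have t: "0 < t" "t \<le> 1 + \<delta>"
    using T_norm[OF \<open>x \<in> ?E\<close>] x \<delta> by (auto simp: t_def)
  define y where "y = inverse t *\<^sub>R T x"
  have "T x \<in> Y"
    using T(1) \<open>x \<in> ?E\<close> by (auto simp: linear_map_between_def)
  then have "y \<in> Y"
    unfolding y_def using \<open>subspace Y\<close> by (rule subspace_scale[rotated])
  moreover have "norm y = 1"
    using t by (simp add: y_def t_def)
  moreover have "(1 - \<epsilon>) * (norm z + \<bar>c\<bar>) \<le> norm (z + c *\<^sub>R y)" if "z \<in> Z" for z c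
  proof -
    let ?d = "c / t"
    note add = linear_map_between_fixing_add_scaleR[OF T _ that, of ?d]
    \<comment> \<open>Absorbing the normalisation into the scalar lets the estimate for \<open>x\<close> be used at \<open>c / t\<close>.\<close>
    have eq: "z + c *\<^sub>R y = T (z + ?d *\<^sub>R x)"
      using add(2) Z by (simp add: y_def divide_inverse)
    have "(1 - \<epsilon>) * (1 + \<delta>) \<le> (1 - 3 * \<delta>) * (1 + \<delta>)"
      using \<delta> by (intro mult_right_mono) auto
    also have "\<dots> \<le> (1 - \<delta>)\<^sup>2"
      by (simp add: power2_eq_square algebra_simps)
    finally have const: "1 - \<epsilon> \<le> (1 - \<delta>)\<^sup>2 / (1 + \<delta>)"
      using \<delta> by (simp add: field_simps)
    have "norm z \<le> norm z * (1 + \<delta>)"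
      using \<delta> by (simp add: algebra_simps)
    moreover have "\<bar>c\<bar> \<le> \<bar>?d\<bar> * (1 + \<delta>)"
      using t mult_right_mono[OF t(2), of "\<bar>c\<bar>"] by (simp add: field_simps)
    ultimately have "norm z + \<bar>c\<bar> \<le> (norm z + \<bar>?d\<bar>) * (1 + \<delta>)"
      using add_mono by (simp only: distrib_right)
    then have "(norm z + \<bar>c\<bar>) / (1 + \<delta>) \<le> norm z + \<bar>?d\<bar>"
      using \<delta> by (simp only: pos_divide_le_eq)
    then have "(1 - \<delta>)\<^sup>2 * ((norm z + \<bar>c\<bar>) / (1 + \<delta>)) \<le> (1 - \<delta>)\<^sup>2 * (norm z + \<bar>?d\<bar>)"
      by (intro mult_left_mono) auto
    moreover have "(1 - \<epsilon>) * (norm z + \<bar>c\<bar>) \<le> (1 - \<delta>)\<^sup>2 / (1 + \<delta>) * (norm z + \<bar>c\<bar>)"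
      using const by (intro mult_right_mono) auto
    ultimately have "(1 - \<epsilon>) * (norm z + \<bar>c\<bar>) \<le> (1 - \<delta>) * ((1 - \<delta>) * (norm z + \<bar>?d\<bar>))"
      by (simp add: power2_eq_square mult.assoc)
    also have "\<dots> \<le> (1 - \<delta>) * norm (z + ?d *\<^sub>R x)"
      using oct_x[OF that, of ?d] \<delta> by (intro mult_left_mono) simp_all
    also have "\<dots> \<le> norm (z + c *\<^sub>R y)"
      using T_norm add(1) Z by (simp add: eq)
    finally show ?thesis .
  qed
  ultimately show "\<exists>y\<in>Y. norm y = 1 \<and> (\<forall>z\<in>Z. \<forall>c. norm (z + c *\<^sub>R y) \<ge> (1 - \<epsilon>) * (norm z + \<bar>c\<bar>))"
    by blast
qed

lemma fails_minus_one_BCP_below_isometric_ideal: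
  fixes Y :: "'a::banach set"
  assumes "Cinfinite \<kappa>"
    and fails: "fails_minus_one_BCP_below \<kappa> (UNIV :: 'a set)" and ideal: "isometric_ideal \<kappa> Y"
  shows "fails_minus_one_BCP_below \<kappa> Y"
  unfolding fails_minus_one_BCP_below_def
proof (intro allI impI)
  fix Z :: "'a set"
  assume Z: "subspace Z \<and> Z \<subseteq> Y \<and> dens Z <o \<kappa>"
  obtain x where x: "norm x = 1"
    and orth: "\<And>z c. z \<in> Z \<Longrightarrow> norm (z + c *\<^sub>R x) = norm z + \<bar>c\<bar>"
    using fails Z unfolding fails_minus_one_BCP_below_def by blast
  let ?E = "span (insert x Z)"
  have "dens ?E <o \<kappa>"
    using assms(1) Z dens_span_insert_less by blast
  then obtain T where T: "linear_map_between ?E Y T" "\<forall>e \<in> ?E \<inter> Y. T e = e"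
    and T_norm: "\<And>e. e \<in> ?E \<Longrightarrow> norm (T e) = norm e"
    using ideal subspace_span unfolding isometric_ideal_def by meson
  have "x \<in> ?E"
    by (simp add: span_base)
  then have "T x \<in> Y" "norm (T x) = 1"
    using T(1) T_norm x by (auto simp: linear_map_between_def)
  moreover have "norm (z + c *\<^sub>R T x) = norm z + \<bar>c\<bar>" if "z \<in> Z" for z c
    using linear_map_between_fixing_add_scaleR[OF T _ that, of c] T_norm orth[OF that] Z by metis
  ultimately show "\<exists>y\<in>Y. norm y = 1 \<and> (\<forall>z\<in>Z. \<forall>c. norm (z + c *\<^sub>R y) = norm z + \<bar>c\<bar>)"
    by blast
qed

theorem proposition4p14:
  fixes \<kappa> :: "'k rel" and Y :: "'a::banach set"
  assumes "Cinfinite \<kappa>" and "subspace Y"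
  shows "(octahedral_below \<kappa> (UNIV :: 'a set) \<and> almost_isometric_ideal \<kappa> Y
            \<longrightarrow> octahedral_below \<kappa> Y) \<and>
         (fails_minus_one_BCP_below \<kappa> (UNIV :: 'a set) \<and> isometric_ideal \<kappa> Y
            \<longrightarrow> fails_minus_one_BCP_below \<kappa> Y)"
  using octahedral_below_almost_isometric_ideal[OF assms]
    fails_minus_one_BCP_below_isometric_ideal[OF assms(1), of Y]
  by simp

end
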